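(* Let $p, t$ be integers with $0 < t < p$, and let $\mathcal{P} = PG(p-1,2)$. Then: (a) If $t \le p/2$, then there exist two distinct $(t-1)$-dimensional projective subspaces $S_1, S_2$ of $\mathcal{P}$ (so $|S_1| = |S_2| = 2^t-1$) such that $S_1 \cap S_2 = \emptyset$. (b) If $t > p/2$, then for any two distinct $(t-1)$-dimensional projective subspaces $S_1, S_2$ of $\mathcal{P}$ one has $|S_1 \cap S_2| \ge 2^{2t-p}-1$, and there exist two distinct such subspaces $S_1, S_2$ for which equality holds.
   Context: $PG(p-1,2)$ denotes the $(p-1)$-dimensional projective geometry over $GF(2)$; its set of points is identified with the set of nonzero vectors of $GF(2)^p$, so it has $2^p-1$ points. A $(t-1)$-dimensional projective subspace of $PG(p-1,2)$ is the set of nonzero vectors of a $t$-dimensional linear subspace of $GF(2)^p$; it has $2^t-1$ points. Intersections and cardinalities refer to these sets of points (the zero vector is never included). *)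

theory Defs
  imports "HOL-Analysis.Cartesian_Space" "HOL-Library.Z2"
begin

text \<open>
  The type \<open>bit ^ 'n\<close> is the vector space of dimension \<open>CARD('n)\<close> over the field with two
  elements. As the only nonzero scalar is \<open>1\<close>, a point of the projective geometry is the
  same thing as a nonzero vector.
\<close>

definition PG_points :: "(bit ^ 'n) set" where
  "PG_points = UNIV - {0}"

text \<open>The first argument is the projective dimension, one less than the linear dimension.\<close>

definition projective_subspace :: "nat \<Rightarrow> (bit ^ 'n) set \<Rightarrow> bool" where
  "projective_subspace d S \<longleftrightarrow>
     (\<exists>W. vec.subspace W \<and> vec.dim W = d + 1 \<and> S = W \<inter> PG_points)"

end

theory Submission
  imports Defs
begin

text \<open>Everything reduces to linear dimension: a subspace \<open>W\<close> over GF(2) has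
  \<open>2 ^ vec.dim W\<close> vectors, and discarding the zero vector leaves one fewer point
  (\<open>card_Int_PG_points\<close>). Since U + V lies in the whole space, the formula dim U + dim
  V = dim (U + V) + dim (U \<inter> V) forces dim (U \<inter> V) \<ge> 2t - p
  (\<open>vec_dim_Int_ge\<close>), which is the bound in (b). Coordinate subspaces with supports
  overlapping as little as possible attain it, and for 2t \<le> p they meet only in zero, which
  gives (a) (\<open>projective_subspaces_min_Int\<close>).\<close>

lemma vec_card_span_independent:
  fixes B :: "('a::{field,finite} ^ 'n) set"
  assumes "finite B" and "vec.independent B"
  shows "card (vec.span B) = CARD('a) ^ card B"
  using assms
proof (induction B rule: finite_induct)
  case empty
  show ?case by simp
next
  case (insert b B)
  have b: "b \<notin> vec.span B" and ind: "vec.independent B"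
    using insert by (auto simp: vec.independent_insert)
  \<comment> \<open>Adjoining \<open>b\<close> multiplies the span by the number of scalars, because
    \<open>?f\<close> is a bijection from pairs onto the larger span.\<close>
  let ?f = "\<lambda>(k, y). k *s b + y"
  have "inj_on ?f (UNIV \<times> vec.span B)"
  proof (rule inj_onI, clarify)
    fix k l y z
    assume y: "y \<in> vec.span B" and z: "z \<in> vec.span B"
      and eq: "k *s b + y = l *s b + z"
    have "(k - l) *s b = z - y"
      using eq by (simp add: vec.scale_left_diff_distrib algebra_simps)
    then have "(k - l) *s b \<in> vec.span B"
      using y z by (simp add: vec.span_diff)
    \<comment> \<open>Otherwise dividing by \<open>k - l\<close> would put \<open>b\<close> into the
      span of \<open>B\<close>.\<close>
    then have "k = l"
      using b vec.span_scale[of "(k - l) *s b" B "inverse (k - l)"] by (cases "k = l") auto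
    then show "k = l \<and> y = z" using eq by simp
  qed
  moreover have "?f ` (UNIV \<times> vec.span B) = vec.span (insert b B)"
  proof (intro equalityI subsetI)
    fix x assume "x \<in> vec.span (insert b B)"
    then obtain k where "x - k *s b \<in> vec.span B"
      by (auto simp: vec.span_breakdown_eq)
    then show "x \<in> ?f ` (UNIV \<times> vec.span B)"
      by (intro image_eqI[of _ _ "(k, x - k *s b)"]) auto
  next
    fix x assume "x \<in> ?f ` (UNIV \<times> vec.span B)"
    then obtain k y where "y \<in> vec.span B" "x = k *s b + y" by auto
    then show "x \<in> vec.span (insert b B)"
      by (auto simp: vec.span_breakdown_eq intro!: exI[of _ k])
  qed
  ultimately have "card (vec.span (insert b B)) = CARD('a) * card (vec.span B)"
    by (metis card_image card_cartesian_product)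
  then show ?case using insert ind by simp
qed

lemma vec_card_subspace:
  fixes W :: "('a::{field,finite} ^ 'n) set"
  assumes "vec.subspace W"
  shows "card W = CARD('a) ^ vec.dim W"
proof -
  obtain B where B: "B \<subseteq> W" "vec.independent B" "W \<subseteq> vec.span B" "card B = vec.dim W"
    using vec.basis_exists by metis
  then have "vec.span B = W"
    using assms vec.span_minimal by blast
  then show ?thesis
    using B vec_card_span_independent[of B] vec.finiteI_independent by metis
qed

lemma vec_dim_Int_ge:
  fixes U V :: "('a::field ^ 'n) set"
  assumes "vec.subspace U" and "vec.subspace V"
  shows "vec.dim U + vec.dim V \<le> vec.dim (U \<inter> V) + CARD('n)"
proof -
  have "vec.dim {x + y |x y. x \<in> U \<and> y \<in> V} \<le> CARD('n)"
    by (rule dim_subset_UNIV_cart_gen)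
  then show ?thesis
    using vec.dim_sums_Int[OF assms] by linarith
qed

lemma UNIV_bit: "(UNIV :: bit set) = {0, 1}"
  by (auto intro: bit.exhaust)

text \<open>Makes the counting lemmas, stated over a finite field, applicable to
  \<open>bit\<close>.\<close>

instance bit :: finite
  by standard (simp add: UNIV_bit)

lemma card_Int_PG_points:
  fixes W :: "(bit ^ 'n) set"
  assumes "vec.subspace W"
  shows "card (W \<inter> PG_points) = 2 ^ vec.dim W - 1"
proof -
  have "W \<inter> PG_points = W - {0}" by (auto simp: PG_points_def)
  then show ?thesis
    using assms vec_card_subspace[OF assms] by (simp add: UNIV_bit numeral_2_eq_2 vec.subspace_0)
qed

text \<open>Positivity of \<open>t\<close> turns the truncated \<open>t - 1 + 1\<close> back into
  \<open>t\<close>.\<close>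

lemma projective_subspace_obtain:
  assumes "projective_subspace (t - 1) S" and "0 < t"
  obtains W where "vec.subspace W" "vec.dim W = t" "S = W \<inter> PG_points"
  using assms by (auto simp: projective_subspace_def)

lemma card_projective_subspace_Int_ge:
  fixes S1 S2 :: "(bit ^ 'n) set"
  assumes "projective_subspace (t - 1) S1" and "projective_subspace (t - 1) S2" and "0 < t"
  shows "2 ^ (2 * t - CARD('n)) - 1 \<le> card (S1 \<inter> S2)"
proof -
  obtain U V where U: "vec.subspace U" "vec.dim U = t" "S1 = U \<inter> PG_points"
    and V: "vec.subspace V" "vec.dim V = t" "S2 = V \<inter> PG_points"
    using assms projective_subspace_obtain by metis
  have "S1 \<inter> S2 = (U \<inter> V) \<inter> PG_points"
    using U V by blast
  then have "card (S1 \<inter> S2) = 2 ^ vec.dim (U \<inter> V) - 1"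
    using card_Int_PG_points[OF vec.subspace_inter[OF U(1) V(1)]] by simp
  moreover have "2 * t - CARD('n) \<le> vec.dim (U \<inter> V)"
    using vec_dim_Int_ge[OF U(1) V(1)] U V by linarith
  then have "(2::nat) ^ (2 * t - CARD('n)) \<le> 2 ^ vec.dim (U \<inter> V)"
    by (rule power_increasing) simp
  ultimately show ?thesis
    by linarith
qed

text \<open>
  The subspaces supported on the first and on the last \<open>t\<close> coordinates. Their supports share
  \<open>2 * t - CARD('n)\<close> coordinates, where the truncated subtraction gives \<open>0\<close> when the supports
  are disjoint, so both parts of the theorem have the same witness.
\<close>

lemma projective_subspaces_min_Int:
  assumes "0 < t" and "t < CARD('n::finite)"
  obtains S1 S2 :: "(bit ^ 'n) set"
  where "projective_subspace (t - 1) S1" "projective_subspace (t - 1) S2" "S1 \<noteq> S2"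
    "card S1 = 2 ^ t - 1" "card S2 = 2 ^ t - 1"
    "card (S1 \<inter> S2) = 2 ^ (2 * t - CARD('n)) - 1"
proof -
  let ?p = "CARD('n)"
  obtain f :: "nat \<Rightarrow> 'n" where f: "bij_betw f {0..<?p} UNIV"
    using ex_bij_betw_nat_finite[of "UNIV :: 'n set"] by auto
  \<comment> \<open>Vectors supported on \<open>A\<close>: the dimension is \<open>card A\<close>
    and intersections of supports give intersections of subspaces, so only index sets remain to be
    counted.\<close>
  define W :: "'n set \<Rightarrow> (bit ^ 'n) set" where "W A = {x. \<forall>i. i \<notin> A \<longrightarrow> x $ i = 0}" for A
  have sub: "vec.subspace (W A)" for A
    by (simp add: W_def vec.subspace_def)
  have dim: "vec.dim (W A) = card A" for A
    unfolding W_def by (rule dim_substandard_cart)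
  have card_f: "card (f ` I) = card I" if "I \<subseteq> {0..<?p}" for I
    using f that by (meson bij_betw_def card_image inj_on_subset)
  define A B where "A = f ` {0..<t}" and "B = f ` {?p - t..<?p}"
  have A: "card A = t" and B: "card B = t"
    using assms card_f[of "{0..<t}"] card_f[of "{?p - t..<?p}"] by (auto simp: A_def B_def)
  have "A \<inter> B = f ` ({0..<t} \<inter> {?p - t..<?p})"
    unfolding A_def B_def using f assms
    by (intro inj_on_image_Int[symmetric, of f "{0..<?p}"]) (auto simp: bij_betw_def)
  \<comment> \<open>This interval is empty when 2t \<le> p and otherwise has t - (p - t)
    elements.\<close>
  also have "{0..<t} \<inter> {?p - t..<?p} = {?p - t..<t}"
    using assms by auto
  finally have AB: "card (A \<inter> B) = 2 * t - ?p"
    using assms card_f[of "{?p - t..<t}"] by auto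
  define S1 S2 where "S1 = W A \<inter> PG_points" and "S2 = W B \<inter> PG_points"
  have proj: "projective_subspace (t - 1) S1" "projective_subspace (t - 1) S2"
    unfolding projective_subspace_def S1_def S2_def
    using sub dim A B assms by (auto intro: exI[of _ "W A"] exI[of _ "W B"])
  have cards: "card S1 = 2 ^ t - 1" "card S2 = 2 ^ t - 1"
    unfolding S1_def S2_def using card_Int_PG_points sub dim A B by metis+
  have "S1 \<inter> S2 = W (A \<inter> B) \<inter> PG_points"
    by (auto simp: S1_def S2_def W_def)
  then have Int: "card (S1 \<inter> S2) = 2 ^ (2 * t - ?p) - 1"
    using card_Int_PG_points[OF sub] dim AB by simp
  \<comment> \<open>Distinctness comes from counting: the exponent is below \<open>t\<close> by
    \<open>t < ?p\<close>, or by \<open>0 < t\<close> when the subtraction truncates to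
    zero.\<close>
  have "(2::nat) ^ (2 * t - ?p) < 2 ^ t"
    using assms by (intro power_strict_increasing) auto
  moreover have "(1::nat) \<le> 2 ^ (2 * t - ?p)" by simp
  ultimately have "card (S1 \<inter> S2) < card S1"
    using Int cards by linarith
  then have "S1 \<noteq> S2" by auto
  then show thesis using that proj cards Int by blast
qed

theorem theorem3:
  fixes p t :: nat
  assumes "CARD('n::finite) = p" and "0 < t" and "t < p"
  shows "(real t \<le> real p / 2 \<longrightarrow>
            (\<exists>S1 S2 :: (bit ^ 'n) set.
               projective_subspace (t - 1) S1 \<and> projective_subspace (t - 1) S2 \<and> S1 \<noteq> S2 \<and>
               card S1 = 2 ^ t - 1 \<and> card S2 = 2 ^ t - 1 \<and> S1 \<inter> S2 = {})) \<and>
         (real t > real p / 2 \<longrightarrow>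
            (\<forall>S1 S2 :: (bit ^ 'n) set.
               projective_subspace (t - 1) S1 \<and> projective_subspace (t - 1) S2 \<and> S1 \<noteq> S2 \<longrightarrow>
               card (S1 \<inter> S2) \<ge> 2 ^ (2 * t - p) - 1) \<and>
            (\<exists>S1 S2 :: (bit ^ 'n) set.
               projective_subspace (t - 1) S1 \<and> projective_subspace (t - 1) S2 \<and> S1 \<noteq> S2 \<and>
               card (S1 \<inter> S2) = 2 ^ (2 * t - p) - 1))"
proof -
  obtain S1 S2 :: "(bit ^ 'n) set"
    where S: "projective_subspace (t - 1) S1" "projective_subspace (t - 1) S2" "S1 \<noteq> S2"
      "card S1 = 2 ^ t - 1" "card S2 = 2 ^ t - 1" "card (S1 \<inter> S2) = 2 ^ (2 * t - p) - 1"
    using projective_subspaces_min_Int[where 'n = 'n] assms by metis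
  have "S1 \<inter> S2 = {}" if "real t \<le> real p / 2"
  proof -
    \<comment> \<open>The intersection then has 2^0 - 1 = 0 points, and it is a finite set, hence
      empty.\<close>
    have "2 * t - p = 0" using that by simp
    then show ?thesis using S(6) by simp
  qed
  then show ?thesis
    using S card_projective_subspace_Int_ge[where 'n = 'n and t = t] assms by blast
qed

end
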